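(* Let $T$ be a complete first-order theory, let $\varphi(x;y)$ be a formula of $T$ without the independence property (NIP), let $\langle P_n : n<\omega\rangle$ be its characteristic sequence, and let $A$ be a positive base set for $\varphi$. Then for each $n<\omega$ there is a localization $P^f_1$ (of $P_1$) such that: (1) $A\subset P^f_1$; (2) $\{y_1,\dots,y_n\}\subset P^f_1 \implies P_n(y_1,\dots,y_n)$.
   Context: $T$ is a complete theory in a language $\mathcal{L}$; $x,y$ may be tuples of variables. Everything is computed in a fixed sufficiently saturated (monster) model $M$ of $T$. Characteristic sequence: $P_n(z_1,\dots,z_n) := \exists x \bigwedge_{i\le n}\varphi(x;z_i)$ for $n\geq 1$. The formulas $P_n$ are identified with their interpretations in $M$; $P_1$ also denotes the set it defines. $P_n$ is symmetric, and whether it holds depends only on the set of its arguments (repetitions allowed). Standing convention: $T\vdash \forall y\exists z\forall x(\varphi(x;z)\leftrightarrow\neg\varphi(x;y))$; if a formula $\chi(x;y)$ does not satisfy this it is replaced by $\theta(x;y,z)=\chi(x;y)\wedge\neg\chi(x;z)$. Thus $\varphi$ either satisfies this condition or is of the form $\chi(x;y)\wedge\neg\chi(x;z)$. A set $A\subset P_1$ (small, possibly empty) is a $P_n$-complete graph if $P_n$ holds on every $n$-tuple from $A$. It is a positive base set if it is a $P_n$-complete graph for all $n$; equivalently $\{\varphi(x;a):a\in A\}$ is consistent. Localization: let $A$ be a positive base set and $B\subset M$. A localization $P^f_1$ of $P_1$ around $A$ with parameters from $B$ is a formula $P^f_1(y)=\bigwedge_{i<m}P_{r_i}(\check\sigma_i,\check\beta_i)$,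 where $m<\omega$, each $\sigma_i\subseteq\{y\}$, each $\beta_i$ is a finite subset of $B$, and $\check\sigma_i,\check\beta_i$ list the elements of these sets (with repetitions if needed to fill the $r_i$ places), such that: (nontriviality) for each $\ell<\omega$ there is a (nonempty) $P_\ell$-complete graph $C_\ell$ with $P^f_1$ holding on all elements of $C_\ell$; and $P^f_1$ holds on all elements of $A$. $P^f_1$ also denotes the set defined.
   Formalization: The formal statement adds that P_1 is nonempty (φ is consistent); otherwise, e.g. for χ(x;y) ∧ ¬χ(x;z) with χ := (x = x) and A empty, no localization exists because nontriviality needs nonempty complete graphs inside P_1. *)

theory Defs
  imports Main
begin

unbundle cardinal_syntax

section \<open>First-order logic with equality\<close>

record ('f, 'p) lang =
  funs :: "'f set"
  rels :: "'p set"
  farity :: "'f \<Rightarrow> nat"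
  rarity :: "'p \<Rightarrow> nat"

datatype 'f tm = Var nat | Fn 'f "'f tm list"

text \<open>Variables are de Bruijn indices: in \<open>Ex \<psi>\<close> the index \<open>0\<close> of \<open>\<psi>\<close> is bound.\<close>

datatype ('f, 'p) fm =
    Eq "'f tm" "'f tm"
  | Rel 'p "'f tm list"
  | Neg "('f, 'p) fm"
  | Conj "('f, 'p) fm" "('f, 'p) fm"
  | Ex "('f, 'p) fm"

text \<open>\<open>wf_fm L n \<psi>\<close>: \<open>\<psi>\<close> is an \<open>L\<close>-formula whose free variables are among the first \<open>n\<close>;
  for \<open>n = 0\<close> these are the \<open>L\<close>-sentences.\<close>

fun wf_tm :: "('f, 'p) lang \<Rightarrow> nat \<Rightarrow> 'f tm \<Rightarrow> bool" where
  "wf_tm L n (Var i) \<longleftrightarrow> i < n"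
| "wf_tm L n (Fn f ts) \<longleftrightarrow> f \<in> funs L \<and> length ts = farity L f \<and> (\<forall>t\<in>set ts. wf_tm L n t)"

fun wf_fm :: "('f, 'p) lang \<Rightarrow> nat \<Rightarrow> ('f, 'p) fm \<Rightarrow> bool" where
  "wf_fm L n (Eq s t) \<longleftrightarrow> wf_tm L n s \<and> wf_tm L n t"
| "wf_fm L n (Rel p ts) \<longleftrightarrow> p \<in> rels L \<and> length ts = rarity L p \<and> (\<forall>t\<in>set ts. wf_tm L n t)"
| "wf_fm L n (Neg \<psi>) \<longleftrightarrow> wf_fm L n \<psi>"
| "wf_fm L n (Conj \<psi> \<chi>) \<longleftrightarrow> wf_fm L n \<psi> \<and> wf_fm L n \<chi>"
| "wf_fm L n (Ex \<psi>) \<longleftrightarrow> wf_fm L (Suc n) \<psi>"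

fun ren_tm :: "(nat \<Rightarrow> nat) \<Rightarrow> 'f tm \<Rightarrow> 'f tm" where
  "ren_tm r (Var i) = Var (r i)"
| "ren_tm r (Fn f ts) = Fn f (map (ren_tm r) ts)"

fun ren_fm :: "(nat \<Rightarrow> nat) \<Rightarrow> ('f, 'p) fm \<Rightarrow> ('f, 'p) fm" where
  "ren_fm r (Eq s t) = Eq (ren_tm r s) (ren_tm r t)"
| "ren_fm r (Rel p ts) = Rel p (map (ren_tm r) ts)"
| "ren_fm r (Neg \<psi>) = Neg (ren_fm r \<psi>)"
| "ren_fm r (Conj \<psi> \<chi>) = Conj (ren_fm r \<psi>) (ren_fm r \<chi>)"
| "ren_fm r (Ex \<psi>) = Ex (ren_fm (case_nat 0 (Suc \<circ> r)) \<psi>)"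

record ('f, 'p, 'a) struct =
  univ :: "'a set"
  fint :: "'f \<Rightarrow> 'a list \<Rightarrow> 'a"
  rint :: "'p \<Rightarrow> 'a list \<Rightarrow> bool"

definition tuples :: "'a set \<Rightarrow> nat \<Rightarrow> 'a list set" where
  "tuples D n = {a. length a = n \<and> set a \<subseteq> D}"

definition is_struct :: "('f, 'p) lang \<Rightarrow> ('f, 'p, 'a) struct \<Rightarrow> bool" where
  "is_struct L M \<longleftrightarrow> univ M \<noteq> {} \<and>
     (\<forall>f\<in>funs L. \<forall>a\<in>tuples (univ M) (farity L f). fint M f a \<in> univ M)"

text \<open>The \<open>i\<close>-th entry of the list \<open>e\<close> is the value of the variable with index \<open>i\<close>.\<close>

fun eval_tm :: "('f, 'p, 'a) struct \<Rightarrow> 'a list \<Rightarrow> 'f tm \<Rightarrow> 'a" where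
  "eval_tm M e (Var i) = e ! i"
| "eval_tm M e (Fn f ts) = fint M f (map (eval_tm M e) ts)"

fun sat :: "('f, 'p, 'a) struct \<Rightarrow> 'a list \<Rightarrow> ('f, 'p) fm \<Rightarrow> bool" where
  "sat M e (Eq s t) \<longleftrightarrow> eval_tm M e s = eval_tm M e t"
| "sat M e (Rel p ts) \<longleftrightarrow> rint M p (map (eval_tm M e) ts)"
| "sat M e (Neg \<psi>) \<longleftrightarrow> \<not> sat M e \<psi>"
| "sat M e (Conj \<psi> \<chi>) \<longleftrightarrow> sat M e \<psi> \<and> sat M e \<chi>"
| "sat M e (Ex \<psi>) \<longleftrightarrow> (\<exists>d\<in>univ M. sat M (d # e) \<psi>)"

lemma eval_ren_tm:
  assumes "wf_tm L n t" "\<And>i. i < n \<Longrightarrow> e' ! r i = e ! i"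
  shows "eval_tm M e' (ren_tm r t) = eval_tm M e t"
  using assms by (induction t) (auto simp: o_def intro!: arg_cong[where f = "fint M _"])

lemma sat_ren_fm:
  assumes "wf_fm L n \<psi>" "\<And>i. i < n \<Longrightarrow> e' ! r i = e ! i"
  shows "sat M e' (ren_fm r \<psi>) \<longleftrightarrow> sat M e \<psi>"
  using assms
proof (induction \<psi> arbitrary: n r e e')
  case (Rel p ts)
  then have "map (eval_tm M e' \<circ> ren_tm r) ts = map (eval_tm M e) ts"
    by (auto intro: eval_ren_tm)
  then show ?case by (simp only: ren_fm.simps sat.simps map_map)
next
  case (Ex \<psi>)
  have "sat M (d # e') (ren_fm (case_nat 0 (Suc \<circ> r)) \<psi>) \<longleftrightarrow> sat M (d # e) \<psi>" for d
    using Ex.prems by (intro Ex.IH[of "Suc n"]) (auto split: nat.split simp: less_Suc_eq_0_disj)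
  then show ?case by simp
next
  case (Eq s t)
  then show ?case by (auto simp: eval_ren_tm)
next
  case (Neg \<psi>)
  then show ?case by auto
next
  case (Conj \<psi> \<chi>)
  then show ?case
    using Conj.IH(1)[of n] Conj.IH(2)[of n] by simp
qed

section \<open>Theories and saturated models\<close>

definition is_model :: "('f, 'p) lang \<Rightarrow> ('f, 'p) fm set \<Rightarrow> ('f, 'p, 'a) struct \<Rightarrow> bool" where
  "is_model L T M \<longleftrightarrow> is_struct L M \<and> (\<forall>\<sigma>\<in>T. sat M [] \<sigma>)"

text \<open>HOL cannot quantify over types, so the models in the semantic consequence relation have
  their universe inside a given type. In what follows it is the type carrying the monster model; if
  the monster is infinite it has more than \<open>|L|\<close> elements, so by Loewenheim-Skolem
  nothing is lost.\<close>

definition entails ::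
    "'a itself \<Rightarrow> ('f, 'p) lang \<Rightarrow> ('f, 'p) fm set \<Rightarrow> ('f, 'p) fm \<Rightarrow> bool" where
  "entails _ L T \<sigma> \<longleftrightarrow> (\<forall>N :: ('f, 'p, 'a) struct. is_model L T N \<longrightarrow> sat N [] \<sigma>)"

definition complete_theory ::
    "'a itself \<Rightarrow> ('f, 'p) lang \<Rightarrow> ('f, 'p) fm set \<Rightarrow> bool" where
  "complete_theory U L T \<longleftrightarrow> (\<forall>\<sigma>\<in>T. wf_fm L 0 \<sigma>) \<and>
     (\<exists>N :: ('f, 'p, 'a) struct. is_model L T N) \<and>
     (\<forall>\<sigma>. wf_fm L 0 \<sigma> \<longrightarrow> entails U L T \<sigma> \<or> entails U L T (Neg \<sigma>))"

text \<open>A pair \<open>(\<psi>, d)\<close> stands for the formula \<open>\<psi>(v; d)\<close> in the variables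
  \<open>v\<^sub>0, \<dots>, v\<^bsub>n-1\<^esub>\<close> with parameters \<open>d\<close>.\<close>

definition saturated :: "('f, 'p) lang \<Rightarrow> 'k rel \<Rightarrow> ('f, 'p, 'a) struct \<Rightarrow> bool" where
  "saturated L \<kappa> M \<longleftrightarrow>
     (\<forall>n D \<Gamma>. D \<subseteq> univ M \<and> |D| <o \<kappa> \<and>
        (\<forall>(\<psi>, d)\<in>\<Gamma>. wf_fm L (n + length d) \<psi> \<and> set d \<subseteq> D) \<and>
        (\<forall>\<Gamma>\<^sub>0. finite \<Gamma>\<^sub>0 \<and> \<Gamma>\<^sub>0 \<subseteq> \<Gamma> \<longrightarrow>
           (\<exists>a\<in>tuples (univ M) n. \<forall>(\<psi>, d)\<in>\<Gamma>\<^sub>0. sat M (a @ d) \<psi>))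
        \<longrightarrow> (\<exists>a\<in>tuples (univ M) n. \<forall>(\<psi>, d)\<in>\<Gamma>. sat M (a @ d) \<psi>))"

text \<open>The subsets of the monster model of cardinality less than \<open>\<kappa>\<close> are the small ones.\<close>

definition monster ::
    "('f, 'p) lang \<Rightarrow> ('f, 'p) fm set \<Rightarrow> 'k rel \<Rightarrow> ('f, 'p, 'a) struct \<Rightarrow> bool" where
  "monster L T \<kappa> M \<longleftrightarrow> is_model L T M \<and> Cinfinite \<kappa> \<and>
     |{\<psi>. \<exists>n. wf_fm L n \<psi>}| <o \<kappa> \<and> saturated L \<kappa> M"

section \<open>Partitioned formulas\<close>

text \<open>A partitioned formula \<open>\<phi>(x; y)\<close> with \<open>|x| = k\<close> and \<open>|y| = l\<close> is a formula in
  \<open>k + l\<close> variables, the first \<open>k\<close> of which form \<open>x\<close>; thus \<open>\<phi>(a; b)\<close> is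
  \<open>sat M (a @ b) \<phi>\<close>.\<close>

definition neg_closed ::
    "'a itself \<Rightarrow> ('f, 'p) lang \<Rightarrow> ('f, 'p) fm set \<Rightarrow> nat \<Rightarrow> nat \<Rightarrow> ('f, 'p) fm \<Rightarrow> bool" where
  "neg_closed _ L T k l \<phi> \<longleftrightarrow>
     (\<forall>N :: ('f, 'p, 'a) struct. is_model L T N \<longrightarrow>
        (\<forall>b\<in>tuples (univ N) l. \<exists>c\<in>tuples (univ N) l. \<forall>a\<in>tuples (univ N) k.
           sat N (a @ c) \<phi> \<longleftrightarrow> \<not> sat N (a @ b) \<phi>))"

text \<open>\<open>\<chi>(x; y) \<and> \<not> \<chi>(x; z)\<close>, with \<open>|x| = k\<close>, \<open>|y| = |z| = l\<close> and
  parameter variables \<open>y @ z\<close>.\<close>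

definition diff_fm :: "nat \<Rightarrow> nat \<Rightarrow> ('f, 'p) fm \<Rightarrow> ('f, 'p) fm" where
  "diff_fm k l \<chi> = Conj \<chi> (Neg (ren_fm (\<lambda>i. if i < k then i else i + l) \<chi>))"

lemma sat_diff_fm:
  assumes "wf_fm L (k + l) \<chi>" "length a = k" "length b = l" "length c = l"
  shows "sat M (a @ (b @ c)) (diff_fm k l \<chi>) \<longleftrightarrow> sat M (a @ b) \<chi> \<and> \<not> sat M (a @ c) \<chi>"
proof -
  have "ren_tm id t = t" for t :: "'f tm"
    by (induction t) (auto simp: map_idI)
  moreover have "case_nat 0 (Suc \<circ> id) = id"
    by (auto simp: fun_eq_iff split: nat.split)
  ultimately have ren_id: "ren_fm id \<psi> = \<psi>" for \<psi> :: "('f, 'b) fm"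
    by (induction \<psi>) (auto simp: map_idI)
  have "sat M (a @ (b @ c)) (ren_fm id \<chi>) \<longleftrightarrow> sat M (a @ b) \<chi>"
    using assms by (intro sat_ren_fm[of L "k + l"]) (auto simp: nth_append)
  moreover have "sat M (a @ (b @ c)) (ren_fm (\<lambda>i. if i < k then i else i + l) \<chi>)
      \<longleftrightarrow> sat M (a @ c) \<chi>"
    using assms by (intro sat_ren_fm[of L "k + l"]) (auto simp: nth_append)
  ultimately show ?thesis
    by (simp add: diff_fm_def ren_id)
qed

definition convention ::
    "'a itself \<Rightarrow> ('f, 'p) lang \<Rightarrow> ('f, 'p) fm set \<Rightarrow> nat \<Rightarrow> nat \<Rightarrow> ('f, 'p) fm \<Rightarrow> bool" where
  "convention U L T k l \<phi> \<longleftrightarrow> neg_closed U L T k l \<phi> \<or>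
     (\<exists>l' \<chi>. wf_fm L (k + l') \<chi> \<and> l = l' + l' \<and> \<phi> = diff_fm k l' \<chi>)"

definition independence_property ::
    "('f, 'p, 'a) struct \<Rightarrow> nat \<Rightarrow> nat \<Rightarrow> ('f, 'p) fm \<Rightarrow> bool" where
  "independence_property M k l \<phi> \<longleftrightarrow>
     (\<forall>n::nat. \<exists>b. (\<forall>i<n. b i \<in> tuples (univ M) l) \<and>
        (\<forall>S \<subseteq> {..<n}. \<exists>a\<in>tuples (univ M) k. \<forall>i<n. sat M (a @ b i) \<phi> \<longleftrightarrow> i \<in> S))"

section \<open>The characteristic sequence and localizations\<close>

definition P :: "('f, 'p, 'a) struct \<Rightarrow> nat \<Rightarrow> nat \<Rightarrow> ('f, 'p) fm \<Rightarrow> nat \<Rightarrow> 'a list list \<Rightarrow> bool" where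
  "P M k l \<phi> n bs \<longleftrightarrow> length bs = n \<and> set bs \<subseteq> tuples (univ M) l \<and>
     (\<exists>a\<in>tuples (univ M) k. \<forall>b\<in>set bs. sat M (a @ b) \<phi>)"

definition P1 :: "('f, 'p, 'a) struct \<Rightarrow> nat \<Rightarrow> nat \<Rightarrow> ('f, 'p) fm \<Rightarrow> 'a list set" where
  "P1 M k l \<phi> = {b. P M k l \<phi> 1 [b]}"

definition complete_graph ::
    "('f, 'p, 'a) struct \<Rightarrow> nat \<Rightarrow> nat \<Rightarrow> ('f, 'p) fm \<Rightarrow> nat \<Rightarrow> 'a list set \<Rightarrow> bool" where
  "complete_graph M k l \<phi> n C \<longleftrightarrow> C \<subseteq> P1 M k l \<phi> \<and>
     (\<forall>bs. length bs = n \<and> set bs \<subseteq> C \<longrightarrow> P M k l \<phi> n bs)"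

definition positive_base ::
    "('f, 'p, 'a) struct \<Rightarrow> nat \<Rightarrow> nat \<Rightarrow> ('f, 'p) fm \<Rightarrow> 'a list set \<Rightarrow> bool" where
  "positive_base M k l \<phi> A \<longleftrightarrow> (\<forall>n. complete_graph M k l \<phi> n A)"

text \<open>A list of pairs \<open>(s, \<beta>)\<close> represents the formula in \<open>y\<close> that is the conjunction of the
  \<open>P\<^sub>r(y, \<dots>, y, \<beta>)\<close>, with \<open>s\<close> copies of \<open>y\<close> (so \<open>\<sigma> = {}\<close> if \<open>s = 0\<close> and
  \<open>\<sigma> = {y}\<close> otherwise), followed by the list \<open>\<beta>\<close> of parameters, and \<open>r = s + length \<beta>\<close>.\<close>

definition loc_set ::
    "('f, 'p, 'a) struct \<Rightarrow> nat \<Rightarrow> nat \<Rightarrow> ('f, 'p) fm \<Rightarrow> (nat \<times> 'a list list) list \<Rightarrow> 'a list set" where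
  "loc_set M k l \<phi> F =
     {y\<in>tuples (univ M) l. \<forall>(s, \<beta>)\<in>set F. P M k l \<phi> (s + length \<beta>) (replicate s y @ \<beta>)}"

definition localization ::
    "('f, 'p, 'a) struct \<Rightarrow> nat \<Rightarrow> nat \<Rightarrow> ('f, 'p) fm \<Rightarrow> 'a list set \<Rightarrow> 'a set \<Rightarrow>
     (nat \<times> 'a list list) list \<Rightarrow> bool" where
  "localization M k l \<phi> A B F \<longleftrightarrow>
     (\<forall>(s, \<beta>)\<in>set F. 1 \<le> s + length \<beta> \<and> set \<beta> \<subseteq> tuples B l) \<and>
     (\<forall>m. \<exists>C. C \<noteq> {} \<and> complete_graph M k l \<phi> m C \<and> C \<subseteq> loc_set M k l \<phi> F) \<and>
     A \<subseteq> loc_set M k l \<phi> F"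

end

theory Submission
  imports Defs "HOL-Real_Asymp.Real_Asymp"
begin

text \<open>
  Suppose that \<open>A\<close> is nonempty and that no localization around \<open>A\<close> forces \<open>P\<^sub>n\<close>. Then rows can be
  chosen one after the other, each an \<open>n\<close>-tuple on which \<open>P\<^sub>n\<close> fails, so that every path choosing
  one entry from each row is consistent, even together with any finite part of \<open>A\<close>
  (\<open>array_exists\<close>). For the next row, take the conditions \<open>P(y, A\<^sub>0, p)\<close>, where \<open>p\<close> is a path through
  the rows found so far and \<open>A\<^sub>0 \<subseteq> A\<close> is finite. Finitely many of them form a localization
  around \<open>A\<close>, since \<open>A\<^sub>0 \<union> {a} \<union> p\<close> is consistent for each \<open>a \<in> A\<close>. By assumption \<open>n\<close> points that
  satisfy them can violate \<open>P\<^sub>n\<close>, and saturation yields one such \<open>n\<close>-tuple that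
  satisfies all the conditions at once (\<open>row_extension\<close>).

  Such an array with \<open>m\<close> rows has few points but many \<open>\<phi>\<close>-types. The set of entries satisfying
  \<open>\<phi>(a; _)\<close> contains no row, so it contains at most \<open>(n - 1)\<^sup>m\<close> of the \<open>n\<^sup>m\<close> paths (for rows with
  distinct entries; in general the proportions are bounded in this way). Every path
  lies in one of these sets, hence there are at least \<open>(n / (n - 1))\<^sup>m\<close> of them
  (\<open>transversal_cover_bound\<close>; for \<open>n = 1\<close> such an array cannot exist at all). This is exponential in \<open>m\<close>, while the array has at most \<open>n m\<close> points;
  by the Sauer-Shelah lemma (\<open>sauer_shelah_bound\<close>) arbitrarily large sets of points are shattered by
  \<open>\<phi>\<close>, which is the independence property (\<open>array_imp_independence_property\<close>).

  Nontriviality of a localization is automatic for nonempty \<open>A\<close>, because \<open>A\<close> itself is a complete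
  graph of every arity. An empty \<open>A\<close> is replaced by a singleton from \<open>P\<^sub>1\<close>.
\<close>

section \<open>The Sauer-Shelah lemma\<close>

definition shatters :: "'a set set \<Rightarrow> 'a set \<Rightarrow> bool" where
  "shatters \<F> S \<longleftrightarrow> (\<forall>R\<subseteq>S. \<exists>T\<in>\<F>. T \<inter> S = R)"

lemma shattersE:
  assumes "shatters \<F> S" "R \<subseteq> S"
  obtains T where "T \<in> \<F>" "T \<inter> S = R"
  using assms unfolding shatters_def by blast

text \<open>Pajor's form of the Sauer-Shelah lemma, which admits a direct induction on \<open>Z\<close>. Split \<open>\<F>\<close> at a
  new point \<open>x\<close> into the sets without \<open>x\<close> and the sets with \<open>x\<close>, the latter with \<open>x\<close> removed. A set
  shattered by one part is shattered by \<open>\<F>\<close>; one shattered by both parts can in addition be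
  enlarged by \<open>x\<close>, and so counts twice, as it does in the sum of the two inductive bounds.\<close>

lemma card_le_card_shattered:
  assumes "finite Z" "\<F> \<subseteq> Pow Z"
  shows "card \<F> \<le> card {S. S \<subseteq> Z \<and> shatters \<F> S}"
  using assms
proof (induction Z arbitrary: \<F> rule: finite_induct)
  case empty
  then have "\<F> = {} \<or> \<F> = {{}}" by auto
  then show ?case
  proof
    assume "\<F> = {{}}"
    then have "{S. S \<subseteq> {} \<and> shatters \<F> S} = {{}}" by (auto simp: shatters_def)
    then show ?thesis using \<open>\<F> = {{}}\<close> by simp
  qed simp
next
  case (insert x Z)
  define F0 where "F0 = {T \<in> \<F>. x \<notin> T}"
  define F1 where "F1 = {T. x \<notin> T \<and> insert x T \<in> \<F>}"
  define sh where "sh = (\<lambda>\<G>. {S. S \<subseteq> Z \<and> shatters \<G> S})"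
  have sub: "F0 \<subseteq> Pow Z" "F1 \<subseteq> Pow Z"
    using insert.prems by (auto simp: F0_def F1_def)
  then have fin: "finite F0" "finite F1"
    using \<open>finite Z\<close> by (auto intro: finite_subset)
  have fin_sh: "finite (sh \<G>)" for \<G>
    using \<open>finite Z\<close> by (simp add: sh_def)
  have inj: "inj_on (insert x) {S. x \<notin> S}"
    by (intro inj_onI) (simp add: insert_ident)
  have "T \<in> insert x ` F1" if "T \<in> \<F>" "x \<in> T" for T
    using that by (intro image_eqI[of _ _ "T - {x}"]) (auto simp: F1_def insert_absorb)
  then have "\<F> = F0 \<union> insert x ` F1"
    by (auto simp: F0_def F1_def)
  moreover have "F0 \<inter> insert x ` F1 = {}" by (auto simp: F0_def)
  ultimately have "card \<F> = card F0 + card (insert x ` F1)"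
    using fin by (simp add: card_Un_disjoint)
  also have "card (insert x ` F1) = card F1"
    by (intro card_image inj_on_subset[OF inj]) (auto simp: F1_def)
  also have "card F0 + card F1 \<le> card (sh F0) + card (sh F1)"
    using insert.IH[OF sub(1)] insert.IH[OF sub(2)] by (simp add: sh_def)
  also have "\<dots> = card (sh F0 \<union> sh F1) + card (sh F0 \<inter> sh F1)"
    by (intro card_Un_Int fin_sh)
  also have "card (sh F0 \<inter> sh F1) = card (insert x ` (sh F0 \<inter> sh F1))"
    using insert.hyps by (intro card_image[symmetric] inj_on_subset[OF inj]) (auto simp: sh_def)
  also have "card (sh F0 \<union> sh F1) + card (insert x ` (sh F0 \<inter> sh F1))
      = card ((sh F0 \<union> sh F1) \<union> insert x ` (sh F0 \<inter> sh F1))"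
    using insert.hyps by (intro card_Un_disjoint[symmetric]) (auto simp: fin_sh sh_def)
  also have "\<dots> \<le> card {S. S \<subseteq> insert x Z \<and> shatters \<F> S}"
  proof (intro card_mono)
    show "finite {S. S \<subseteq> insert x Z \<and> shatters \<F> S}" using \<open>finite Z\<close> by simp
    have "shatters \<F> S" if "S \<subseteq> Z" "shatters F0 S" for S
      using that(2) unfolding shatters_def F0_def by blast
    moreover have "shatters \<F> S" if "S \<subseteq> Z" "shatters F1 S" for S
      unfolding shatters_def
    proof (intro allI impI)
      fix R assume "R \<subseteq> S"
      with that(2) obtain T where "T \<in> F1" "T \<inter> S = R" by (rule shattersE)
      then show "\<exists>T\<in>\<F>. T \<inter> S = R"
        using insert.hyps that by (intro bexI[of _ "insert x T"]) (auto simp: F1_def)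
    qed
    moreover have "shatters \<F> (insert x S)"
      if S: "S \<subseteq> Z" "shatters F0 S" "shatters F1 S" for S
      unfolding shatters_def
    proof (intro allI impI)
      fix R assume R: "R \<subseteq> insert x S"
      then have R': "R - {x} \<subseteq> S" by auto
      show "\<exists>T\<in>\<F>. T \<inter> insert x S = R"
      proof (cases "x \<in> R")
        case True
        from S(3) R' obtain T where "T \<in> F1" "T \<inter> S = R - {x}" by (rule shattersE)
        with True show ?thesis
          by (intro bexI[of _ "insert x T"]) (auto simp: F1_def)
      next
        case False
        from S(2) R' obtain T where "T \<in> F0" "T \<inter> S = R - {x}" by (rule shattersE)
        with False show ?thesis
          by (intro bexI[of _ T]) (auto simp: F0_def)
      qed
    qed
    ultimately show "sh F0 \<union> sh F1 \<union> insert x ` (sh F0 \<inter> sh F1)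
        \<subseteq> {S. S \<subseteq> insert x Z \<and> shatters \<F> S}"
      by (auto simp: sh_def)
  qed
  finally show ?case .
qed

text \<open>The estimate is crude; only its polynomial growth in \<open>card Z\<close> for fixed \<open>d\<close> matters.\<close>

lemma sauer_shelah_bound:
  assumes "finite Z" "\<F> \<subseteq> Pow Z" and small: "\<And>S. S \<subseteq> Z \<Longrightarrow> shatters \<F> S \<Longrightarrow> card S < d"
  shows "card \<F> \<le> d * (card Z + 1) ^ d"
proof -
  have "card \<F> \<le> card {S. S \<subseteq> Z \<and> shatters \<F> S}"
    by (intro card_le_card_shattered assms)
  also have "\<dots> \<le> card (\<Union>i<d. {S. S \<subseteq> Z \<and> card S = i})"
    using \<open>finite Z\<close> by (intro card_mono) (auto dest: small)
  also have "\<dots> \<le> (\<Sum>i<d. card {S. S \<subseteq> Z \<and> card S = i})"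
    by (intro card_UN_le) simp
  also have "\<dots> \<le> (\<Sum>i<d. (card Z + 1) ^ d)"
  proof (intro sum_mono)
    fix i assume "i \<in> {..<d}"
    have "card {S. S \<subseteq> Z \<and> card S = i} = card Z choose i"
      by (intro n_subsets \<open>finite Z\<close>)
    also have "\<dots> \<le> card Z ^ i"
      by (cases "i \<le> card Z") (simp_all add: binomial_le_pow binomial_eq_0)
    also have "\<dots> \<le> (card Z + 1) ^ i" by (intro power_mono) auto
    also have "\<dots> \<le> (card Z + 1) ^ d"
      using \<open>i \<in> {..<d}\<close> by (intro power_increasing) auto
    finally show "card {S. S \<subseteq> Z \<and> card S = i} \<le> (card Z + 1) ^ d" .
  qed
  also have "\<dots> = d * (card Z + 1) ^ d" by simp
  finally show ?thesis .
qed

section \<open>Covering the transversals of a family of rows\<close>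

lemma card_listset:
  assumes "\<forall>R\<in>set rows. finite R"
  shows "finite (listset rows)" "card (listset rows) = prod_list (map card rows)"
proof -
  have "finite (listset rows) \<and> card (listset rows) = prod_list (map card rows)"
    using assms
  proof (induction rows)
    case (Cons R rows)
    have "listset (R # rows) = (\<lambda>(x, xs). x # xs) ` (R \<times> listset rows)"
      by (auto simp: set_Cons_def)
    moreover have "inj_on (\<lambda>(x, xs). x # xs) (R \<times> listset rows)"
      by (auto simp: inj_on_def)
    ultimately show ?case using Cons by (auto simp: card_image card_cartesian_product)
  qed simp
  then show "finite (listset rows)" "card (listset rows) = prod_list (map card rows)" by auto
qed

lemma set_subset_Union_if_listset:
  assumes "p \<in> listset rows"
  shows "set p \<subseteq> \<Union>(set rows)"
  using assms by (induction rows arbitrary: p) (fastforce simp: set_Cons_def)+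

lemma listset_restrict:
  assumes "p \<in> listset rows" "set p \<subseteq> T"
  shows "p \<in> listset (map (\<lambda>R. R \<inter> T) rows)"
  using assms by (induction rows arbitrary: p) (auto simp: set_Cons_def)

lemma card_row_restrict:
  assumes "finite R" "card R \<le> n" "\<not> R \<subseteq> T"
  shows "n * card (R \<inter> T) \<le> (n - 1) * card R"
proof -
  have "R \<inter> T \<subset> R" using assms by auto
  then have "card (R \<inter> T) < card R" using \<open>finite R\<close> by (rule psubset_card_mono[rotated])
  then obtain c where c: "card R = Suc c" "card (R \<inter> T) \<le> c"
    by (metis less_eq_Suc_le Suc_le_D Suc_le_mono)
  then obtain n' where n': "n = Suc n'" "c \<le> n'" using assms(2) by (metis Suc_le_D Suc_le_mono)
  have "n * card (R \<inter> T) \<le> Suc n' * c" using c n' by (intro mult_le_mono) auto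
  also have "\<dots> \<le> n' * Suc c" using n' by simp
  finally show ?thesis using c n' by simp
qed

text \<open>A set \<open>T\<close> that contains no row misses an entry of each row. It therefore contains at most a
  proportion \<open>(n - 1) / n\<close> of each row, and at most the \<open>m\<close>-th power of that proportion of all
  transversals, where \<open>m\<close> is the number of rows. The sets in \<open>\<F>\<close> must together contain all
  transversals.\<close>

lemma transversal_cover_bound:
  assumes "finite \<F>"
    and rows: "\<And>R. R \<in> set rows \<Longrightarrow> finite R \<and> R \<noteq> {} \<and> card R \<le> n"
    and cover: "\<And>p. p \<in> listset rows \<Longrightarrow> \<exists>T\<in>\<F>. set p \<subseteq> T"
    and avoid: "\<And>R T. R \<in> set rows \<Longrightarrow> T \<in> \<F> \<Longrightarrow> \<not> R \<subseteq> T"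
  shows "n ^ length rows \<le> card \<F> * (n - 1) ^ length rows"
proof -
  define c where "c = prod_list (map card rows)"
  have "c > 0" using rows by (auto simp: c_def prod_list_zero_iff card_gt_0_iff intro!: Nat.gr0I)
  have bound: "n ^ length rows * card (listset (map (\<lambda>R. R \<inter> T) rows)) \<le> (n - 1) ^ length rows * c"
    if "T \<in> \<F>" for T
  proof -
    have "n ^ length rows * prod_list (map (\<lambda>R. card (R \<inter> T)) rows)
        \<le> (n - 1) ^ length rows * prod_list (map card rows)"
      using rows avoid[OF _ that]
    proof (induction rows)
      case (Cons R rows)
      have "n * card (R \<inter> T) \<le> (n - 1) * card R"
        using Cons.prems by (intro card_row_restrict) auto
      moreover have "n ^ length rows * prod_list (map (\<lambda>R. card (R \<inter> T)) rows)
          \<le> (n - 1) ^ length rows * prod_list (map card rows)"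
        using Cons.prems by (intro Cons.IH) auto
      ultimately have "(n * card (R \<inter> T)) * (n ^ length rows * prod_list (map (\<lambda>R. card (R \<inter> T)) rows))
          \<le> ((n - 1) * card R) * ((n - 1) ^ length rows * prod_list (map card rows))"
        by (rule mult_le_mono)
      then show ?case by (simp add: mult.assoc mult.left_commute)
    qed simp
    then show ?thesis
      using rows by (subst card_listset(2)) (auto simp: c_def o_def)
  qed
  have fin: "finite (listset (map (\<lambda>R. R \<inter> T) rows))" for T
    using rows by (intro card_listset(1)) auto
  have "c = card (listset rows)"
    unfolding c_def using rows by (subst card_listset(2)) auto
  also have "\<dots> \<le> card (\<Union>T\<in>\<F>. listset (map (\<lambda>R. R \<inter> T) rows))"
  proof (intro card_mono)
    show "finite (\<Union>T\<in>\<F>. listset (map (\<lambda>R. R \<inter> T) rows))"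
      using \<open>finite \<F>\<close> fin by simp
    show "listset rows \<subseteq> (\<Union>T\<in>\<F>. listset (map (\<lambda>R. R \<inter> T) rows))"
      using cover listset_restrict by blast
  qed
  also have "\<dots> \<le> (\<Sum>T\<in>\<F>. card (listset (map (\<lambda>R. R \<inter> T) rows)))"
    by (intro card_UN_le \<open>finite \<F>\<close>)
  finally have "n ^ length rows * c
      \<le> (\<Sum>T\<in>\<F>. n ^ length rows * card (listset (map (\<lambda>R. R \<inter> T) rows)))"
    by (simp add: sum_distrib_left[symmetric])
  also have "\<dots> \<le> (\<Sum>T\<in>\<F>. (n - 1) ^ length rows * c)"
    by (intro sum_mono bound)
  also have "\<dots> = (card \<F> * (n - 1) ^ length rows) * c" by simp
  finally show ?thesis using \<open>c > 0\<close> by simp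
qed

text \<open>The left-hand side combines the Sauer-Shelah bound for \<open>n m\<close> points with the factor
  \<open>(n - 1)\<^sup>m\<close> from the count of transversals.\<close>

lemma exponential_beats_polynomial:
  fixes n d :: nat
  assumes "n > 0"
  shows "\<exists>m. d * (n * m + 1) ^ d * (n - 1) ^ m < n ^ m"
proof (cases "n = 1")
  case True
  then show ?thesis by (intro exI[of _ 1]) simp
next
  case False
  define r where "r = real (n - 1) / real n"
  have r: "0 < r" "r < 1" and n: "real n > 0" using assms False by (auto simp: r_def)
  have "((\<lambda>m. real d * (real n * real m + 1) ^ d * r ^ m) \<longlongrightarrow> 0) sequentially"
    using r n by real_asymp
  then have "eventually (\<lambda>m. real d * (real n * real m + 1) ^ d * r ^ m < 1) sequentially"
    by (rule order_tendstoD) simp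
  then obtain m where "real d * (real n * real m + 1) ^ d * r ^ m < 1"
    by (auto simp: eventually_sequentially)
  then have "real d * (real n * real m + 1) ^ d * real (n - 1) ^ m < real n ^ m"
    using n by (simp add: r_def divide_simps)
  then have "real (d * (n * m + 1) ^ d * (n - 1) ^ m) < real (n ^ m)" by (simp add: add.commute)
  then show ?thesis by (metis of_nat_less_iff)
qed

section \<open>Consistency of instances as a formula\<close>

lemma wf_ren_tm:
  assumes "wf_tm L n t" "\<And>i. i < n \<Longrightarrow> r i < n'"
  shows "wf_tm L n' (ren_tm r t)"
  using assms by (induction t) auto

lemma wf_ren_fm:
  assumes "wf_fm L n \<psi>" "\<And>i. i < n \<Longrightarrow> r i < n'"
  shows "wf_fm L n' (ren_fm r \<psi>)"
  using assms
proof (induction \<psi> arbitrary: n n' r)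
  case (Ex \<psi>)
  then show ?case
    by (auto intro!: Ex.IH[of "Suc n"] split: nat.split simp: less_Suc_eq_0_disj)
qed (auto intro: wf_ren_tm)

definition true_fm :: "('f, 'p) fm" where
  "true_fm = Neg (Ex (Neg (Eq (Var 0) (Var 0))))"

text \<open>This is the formula \<open>P\<^sub>r\<close> with its \<open>r\<close> arguments placed inside one long list of parameters:
  \<open>offs\<close> gives the positions where the arguments begin. Fixing positions in this way allows the
  unknown tuple \<open>y\<^sub>1 \<dots> y\<^sub>n\<close> of a type to be one list of \<open>n * l\<close> variables, followed by the parameters.
  In the matrix the variables of \<open>x\<close> come first, so index \<open>k + j\<close> of \<open>\<phi>\<close> becomes
  \<open>q + (k + j)\<close>.\<close>

definition consistent_fm :: "nat \<Rightarrow> ('f, 'p) fm \<Rightarrow> nat list \<Rightarrow> ('f, 'p) fm" where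
  "consistent_fm k \<phi> offs =
     (Ex ^^ k) (foldr Conj (map (\<lambda>q. ren_fm (\<lambda>i. if i < k then i else q + i) \<phi>) offs) true_fm)"

lemma wf_funpow_Ex: "wf_fm L N ((Ex ^^ k) \<psi>) \<longleftrightarrow> wf_fm L (N + k) \<psi>"
  by (induction k arbitrary: N) auto

lemma sat_funpow_Ex:
  "sat M e ((Ex ^^ k) \<psi>) \<longleftrightarrow> (\<exists>a\<in>tuples (univ M) k. sat M (a @ e) \<psi>)"
proof (induction k arbitrary: e)
  case 0
  show ?case by (simp add: tuples_def)
next
  case (Suc k)
  have "sat M e ((Ex ^^ Suc k) \<psi>)
      \<longleftrightarrow> (\<exists>d\<in>univ M. \<exists>a\<in>tuples (univ M) k. sat M ((a @ [d]) @ e) \<psi>)"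
    by (simp add: Suc)
  also have "\<dots> \<longleftrightarrow> (\<exists>a\<in>tuples (univ M) (Suc k). sat M (a @ e) \<psi>)"
  proof
    assume "\<exists>d\<in>univ M. \<exists>a\<in>tuples (univ M) k. sat M ((a @ [d]) @ e) \<psi>"
    then obtain d a where "d \<in> univ M" "a \<in> tuples (univ M) k" "sat M ((a @ [d]) @ e) \<psi>"
      by blast
    then show "\<exists>a\<in>tuples (univ M) (Suc k). sat M (a @ e) \<psi>"
      by (intro bexI[of _ "a @ [d]"]) (auto simp: tuples_def)
  next
    assume "\<exists>a\<in>tuples (univ M) (Suc k). sat M (a @ e) \<psi>"
    then obtain a where a: "length a = Suc k" "set a \<subseteq> univ M" "sat M (a @ e) \<psi>"
      by (auto simp: tuples_def)
    then obtain a' d where "a = a' @ [d]" by (cases a rule: rev_cases) auto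
    with a show "\<exists>d\<in>univ M. \<exists>a\<in>tuples (univ M) k. sat M ((a @ [d]) @ e) \<psi>"
      by (intro bexI[of _ d] bexI[of _ a']) (auto simp: tuples_def)
  qed
  finally show ?case .
qed

lemma wf_consistent_fm:
  assumes "wf_fm L (k + l) \<phi>" "\<forall>q\<in>set offs. q + l \<le> N"
  shows "wf_fm L N (consistent_fm k \<phi> offs)"
proof -
  have "wf_fm L (N + k)
      (foldr Conj (map (\<lambda>q. ren_fm (\<lambda>i. if i < k then i else q + i) \<phi>) offs) true_fm)"
    using assms(2)
  proof (induction offs)
    case Nil
    show ?case by (simp add: true_fm_def)
  next
    case (Cons q offs)
    then show ?case using assms(1) by (auto intro!: wf_ren_fm[of L "k + l"])
  qed
  then show ?thesis by (simp add: consistent_fm_def wf_funpow_Ex)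
qed

lemma sat_consistent_fm:
  assumes "wf_fm L (k + l) \<phi>" "\<forall>q\<in>set offs. q + l \<le> length e"
  shows "sat M e (consistent_fm k \<phi> offs) \<longleftrightarrow>
    (\<exists>a\<in>tuples (univ M) k. \<forall>q\<in>set offs. sat M (a @ take l (drop q e)) \<phi>)"
proof -
  have "sat M (a @ e)
      (foldr Conj (map (\<lambda>q. ren_fm (\<lambda>i. if i < k then i else q + i) \<phi>) offs) true_fm)
      \<longleftrightarrow> (\<forall>q\<in>set offs. sat M (a @ take l (drop q e)) \<phi>)"
    if "length a = k" for a
    using assms(2)
  proof (induction offs)
    case Nil
    show ?case by (simp add: true_fm_def)
  next
    case (Cons q offs)
    have "sat M (a @ e) (ren_fm (\<lambda>i. if i < k then i else q + i) \<phi>)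
        \<longleftrightarrow> sat M (a @ take l (drop q e)) \<phi>"
      using that Cons.prems
      by (intro sat_ren_fm[OF assms(1)]) (auto simp: nth_append)
    with Cons show ?case by simp
  qed
  then show ?thesis by (auto simp: consistent_fm_def sat_funpow_Ex tuples_def)
qed

lemma take_drop_concat:
  assumes "\<forall>b\<in>set bs. length b = l" "i < length bs"
  shows "take l (drop (i * l) (concat bs)) = bs ! i"
  using assms
proof (induction bs arbitrary: i)
  case (Cons b bs)
  then show ?case by (cases i) auto
qed simp

lemma length_concat_blocks:
  assumes "\<forall>b\<in>set bs. length b = l"
  shows "length (concat bs) = length bs * l"
  using assms by (induction bs) auto

section \<open>Building an array by saturation\<close>

text \<open>A version of the characteristic sequence for sets, which disregards order, repetitions and
  arity.\<close>

definition realizable ::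
    "('f, 'p, 'a) struct \<Rightarrow> nat \<Rightarrow> nat \<Rightarrow> ('f, 'p) fm \<Rightarrow> 'a list set \<Rightarrow> bool" where
  "realizable M k l \<phi> X \<longleftrightarrow> X \<subseteq> tuples (univ M) l \<and>
     (\<exists>a\<in>tuples (univ M) k. \<forall>b\<in>X. sat M (a @ b) \<phi>)"

lemma P_iff_realizable: "P M k l \<phi> n bs \<longleftrightarrow> length bs = n \<and> realizable M k l \<phi> (set bs)"
  by (auto simp: P_def realizable_def)

lemma realizable_mono: "realizable M k l \<phi> X \<Longrightarrow> Y \<subseteq> X \<Longrightarrow> realizable M k l \<phi> Y"
  by (auto simp: realizable_def)

text \<open>Consistency of \<open>{\<phi>(x; b) | b \<in> A \<union> E}\<close> for finite \<open>E\<close>, expressed by finite subsets because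
  a localization can state consistency with a finite set only.\<close>

definition compatible ::
    "('f, 'p, 'a) struct \<Rightarrow> nat \<Rightarrow> nat \<Rightarrow> ('f, 'p) fm \<Rightarrow> 'a list set \<Rightarrow> 'a list set \<Rightarrow> bool" where
  "compatible M k l \<phi> A E \<longleftrightarrow>
     (\<forall>A\<^sub>0. finite A\<^sub>0 \<and> A\<^sub>0 \<subseteq> A \<longrightarrow> realizable M k l \<phi> (A\<^sub>0 \<union> E))"

lemma finite_card_less:
  assumes "finite X" "Cinfinite \<kappa>"
  shows "|X| <o \<kappa>"
proof -
  have "Cfinite |X|"
    using assms(1) by (simp add: cfinite_def Field_card_of card_of_card_order_on)
  then show ?thesis using assms(2) by (rule Cfinite_ordLess_Cinfinite)
qed

lemma card_entries_less:
  fixes \<kappa> :: "'k rel" and A B :: "'a list set"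
  assumes \<kappa>: "Cinfinite \<kappa>" and A: "|A| <o \<kappa>" and "finite B"
  shows "|\<Union>(set ` (A \<union> B))| <o \<kappa>"
proof (cases "finite A")
  case True
  then have "finite (\<Union>(set ` (A \<union> B)))" using \<open>finite B\<close> by auto
  then show ?thesis using \<kappa> by (rule finite_card_less)
next
  case False
  then have "Cinfinite |A|" by (simp add: cinfinite_def Field_card_of card_of_card_order_on)
  then have fin_le: "|X| \<le>o |A|" if "finite X" for X :: "'c set"
    using that by (intro ordLess_imp_ordLeq finite_card_less)
  have "|A \<union> B| \<le>o |A|"
    using False fin_le[OF \<open>finite B\<close>]
    by (intro card_of_Un_ordLeq_infinite_Field)
      (auto simp: Field_card_of card_of_card_order_on card_of_mono1)
  moreover have "|set b| \<le>o |A|" for b :: "'a list"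
    by (intro fin_le) simp
  ultimately have "|\<Union>b\<in>A \<union> B. set b| \<le>o |A|"
    using False by (intro card_of_UNION_ordLeq_infinite) auto
  then show ?thesis using A ordLeq_ordLess_trans by blast
qed


lemma saturatedD:
  assumes "saturated L \<kappa> M" "|D| <o \<kappa>" "D \<subseteq> univ M"
    and "\<forall>(\<psi>, d)\<in>\<Gamma>. wf_fm L (n + length d) \<psi> \<and> set d \<subseteq> D"
    and "\<And>\<Gamma>\<^sub>0. finite \<Gamma>\<^sub>0 \<Longrightarrow> \<Gamma>\<^sub>0 \<subseteq> \<Gamma> \<Longrightarrow>
      \<exists>a\<in>tuples (univ M) n. \<forall>(\<psi>, d)\<in>\<Gamma>\<^sub>0. sat M (a @ d) \<psi>"
  shows "\<exists>a\<in>tuples (univ M) n. \<forall>(\<psi>, d)\<in>\<Gamma>. sat M (a @ d) \<psi>"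
  using assms(1)[unfolded saturated_def, THEN spec[of _ n], THEN spec[of _ D], THEN spec[of _ \<Gamma>],
      THEN mp, OF conjI, OF assms(3) conjI, OF assms(2) conjI, OF assms(4)] assms(5)
  by simp

text \<open>One step of the construction: \<open>\<E>\<close> is to be the set of all paths through the rows found so far.
  The assumption \<open>fail\<close> says that no conjunction of instances of the characteristic sequence that
  holds on \<open>A\<close> forces \<open>P\<^sub>n\<close>. The new row realizes a type in \<open>n * l\<close> variables.\<close>

lemma row_extension:
  fixes M :: "('f, 'p, 'a) struct" and \<kappa> :: "'k rel"
  assumes sat: "saturated L \<kappa> M" and \<kappa>: "Cinfinite \<kappa>" and wf: "wf_fm L (k + l) \<phi>"
    and A: "A \<subseteq> tuples (univ M) l" "|A| <o \<kappa>"
    and fin: "finite \<E>" "\<And>E. E \<in> \<E> \<Longrightarrow> finite E"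
    and compat: "\<And>E. E \<in> \<E> \<Longrightarrow> compatible M k l \<phi> A E"
    and fail: "\<And>F. \<forall>(s, \<beta>)\<in>set F. 1 \<le> s + length \<beta> \<and> set \<beta> \<subseteq> tuples (univ M) l \<Longrightarrow>
      A \<subseteq> loc_set M k l \<phi> F \<Longrightarrow>
      \<exists>ys. length ys = n \<and> set ys \<subseteq> loc_set M k l \<phi> F \<and> \<not> realizable M k l \<phi> (set ys)"
  shows "\<exists>ys. length ys = n \<and> set ys \<subseteq> tuples (univ M) l \<and> \<not> realizable M k l \<phi> (set ys) \<and>
    (\<forall>y\<in>set ys. \<forall>E\<in>\<E>. compatible M k l \<phi> A (insert y E))"
proof -
  \<comment> \<open>The type consists of \<open>g\<close>, which says that \<open>P\<^sub>n\<close> fails, and of \<open>G (bs, j)\<close> for \<open>(bs, j) \<in> I\<close>, which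
    says that the \<open>j\<close>-th entry is consistent with a finite part of \<open>A\<close> and a path, together
    listed by \<open>bs\<close>. The parameters of \<open>G (bs, j)\<close> follow the \<open>n\<close> blocks of variables.\<close>
  define I where "I = {(bs, j). j < n \<and> (\<exists>A\<^sub>0\<subseteq>A. \<exists>E\<in>\<E>. set bs = A\<^sub>0 \<union> E)}"
  define D where "D = \<Union>(set ` (A \<union> \<Union>\<E>))"
  define g where "g = (Neg (consistent_fm k \<phi> (map (\<lambda>j. j * l) [0..<n])) :: ('f, 'p) fm, [] :: 'a list)"
  define G where "G = (\<lambda>(bs, j). (consistent_fm k \<phi> (j * l # map (\<lambda>i. (n + i) * l) [0..<length bs]),
    concat bs :: 'a list))"
  define block where "block = (\<lambda>v j. take l (drop (j * l) (v :: 'a list)))"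

  have \<E>_tuples: "E \<subseteq> tuples (univ M) l" if "E \<in> \<E>" for E
    using compat[OF that] by (force simp: compatible_def realizable_def)
  have I_real: "realizable M k l \<phi> (set bs)" if "(bs, j) \<in> I" for bs j
  proof -
    from that obtain A0 E where "A0 \<subseteq> A" "E \<in> \<E>" "set bs = A0 \<union> E" by (auto simp: I_def)
    moreover from this have "finite A0" by (metis List.finite_set finite_Un)
    ultimately show ?thesis using compat by (simp add: compatible_def)
  qed
  have I_len: "\<forall>b\<in>set bs. length b = l" if "(bs, j) \<in> I" for bs j
    using I_real[OF that] by (auto simp: realizable_def tuples_def)
  have block_le: "j * l + l \<le> n * l" if "j < n" for j
    using that by (metis add.commute mult_Suc mult_le_mono1 Suc_leI)

  have sat_g: "(case g of (\<psi>, d) \<Rightarrow> sat M (v @ d) \<psi>) \<longleftrightarrow>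
      \<not> (\<exists>a\<in>tuples (univ M) k. \<forall>j<n. sat M (a @ block v j) \<phi>)"
    if "length v = n * l" for v
    using that block_le unfolding g_def
    by (simp add: sat_consistent_fm[OF wf] block_def atLeast0LessThan Bex_def)
  have sat_G: "(case G (bs, j) of (\<psi>, d) \<Rightarrow> sat M (v @ d) \<psi>) \<longleftrightarrow>
      (\<exists>a\<in>tuples (univ M) k. \<forall>b\<in>insert (block v j) (set bs). sat M (a @ b) \<phi>)"
    if v: "length v = n * l" and I: "(bs, j) \<in> I" for v bs j
  proof -
    have len: "length (concat bs) = length bs * l"
      using I_len[OF I] by (rule length_concat_blocks)
    have j: "j < n" using I by (simp add: I_def)
    have "(n + i) * l + l \<le> length (v @ concat bs)" if "i < length bs" for i
    proof -
      have "(n + i) * l + l = (n + Suc i) * l" by (simp add: algebra_simps)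
      also have "\<dots> \<le> (n + length bs) * l" using that by (intro mult_le_mono1) simp
      finally show ?thesis using v len by (simp add: algebra_simps)
    qed
    moreover have "take l (drop ((n + i) * l) (v @ concat bs)) = bs ! i" if "i < length bs" for i
      using v take_drop_concat[OF I_len[OF I] that] by (simp add: algebra_simps)
    moreover have "take l (drop (j * l) (v @ concat bs)) = block v j"
      using block_le[OF j] v by (simp add: block_def)
    moreover have "j * l + l \<le> length (v @ concat bs)"
      using block_le[OF j] v by simp
    ultimately have "sat M (v @ concat bs)
        (consistent_fm k \<phi> (j * l # map (\<lambda>i. (n + i) * l) [0..<length bs])) \<longleftrightarrow>
      (\<exists>a\<in>tuples (univ M) k. sat M (a @ block v j) \<phi> \<and> (\<forall>i<length bs. sat M (a @ bs ! i) \<phi>))"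
      by (subst sat_consistent_fm[OF wf])
        (simp_all add: ball_Un Bex_def del: length_append take_append drop_append,
          simp add: Ball_def)
    then show ?thesis
      by (simp add: G_def all_set_conv_all_nth[of bs])
  qed

  have "|D| <o \<kappa>"
    unfolding D_def using fin by (intro card_entries_less \<kappa> A) auto
  moreover have "D \<subseteq> univ M"
    using A(1) \<E>_tuples by (force simp: D_def tuples_def)
  moreover have "\<forall>(\<psi>, d)\<in>insert g (G ` I). wf_fm L (n * l + length d) \<psi> \<and> set d \<subseteq> D"
  proof -
    have "wf_fm L (n * l) (fst g)"
      using block_le unfolding g_def by (auto intro!: wf_consistent_fm[OF wf])
    moreover have "wf_fm L (n * l + length (snd (G (bs, j)))) (fst (G (bs, j))) \<and> set (snd (G (bs, j))) \<subseteq> D"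
      if "(bs, j) \<in> I" for bs j
    proof
      have "length (concat bs) = length bs * l"
        using I_len[OF that] by (rule length_concat_blocks)
      moreover have "(n + i) * l + l \<le> n * l + length bs * l" if "i < length bs" for i
      proof -
        have "(n + i) * l + l = (n + Suc i) * l" by (simp add: algebra_simps)
        also have "\<dots> \<le> (n + length bs) * l" using that by (intro mult_le_mono1) simp
        finally show ?thesis by (simp add: algebra_simps)
      qed
      moreover have "j * l + l \<le> n * l" using that by (intro block_le) (simp add: I_def)
      ultimately show "wf_fm L (n * l + length (snd (G (bs, j)))) (fst (G (bs, j)))"
        unfolding G_def by (auto intro!: wf_consistent_fm[OF wf])
      show "set (snd (G (bs, j))) \<subseteq> D"
        using that by (fastforce simp: G_def D_def I_def)
    qed
    ultimately show ?thesis by (auto simp: case_prod_beta g_def)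
  qed
  moreover have "\<exists>v\<in>tuples (univ M) (n * l). \<forall>(\<psi>, d)\<in>\<Gamma>\<^sub>0. sat M (v @ d) \<psi>"
    if "finite \<Gamma>\<^sub>0" "\<Gamma>\<^sub>0 \<subseteq> insert g (G ` I)" for \<Gamma>\<^sub>0
  proof -
    \<comment> \<open>A finite part of the type, apart from \<open>g\<close>, is the localization \<open>F\<close> imposed on each entry.\<close>
    have "finite (\<Gamma>\<^sub>0 - {g})" "\<Gamma>\<^sub>0 - {g} \<subseteq> G ` I" using that by auto
    then obtain I0 where I0: "I0 \<subseteq> I" "finite I0" "\<Gamma>\<^sub>0 - {g} = G ` I0"
      by (meson finite_subset_image)
    then obtain js where js: "set js = I0" using finite_list by blast
    define F where "F = map (\<lambda>(bs, j). (1 :: nat, bs)) js"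
    have loc: "loc_set M k l \<phi> F = {y \<in> tuples (univ M) l.
        \<forall>(bs, j)\<in>I0. realizable M k l \<phi> (insert y (set bs))}"
      by (simp add: loc_set_def F_def P_iff_realizable js split_def)
    have "\<forall>(s, \<beta>)\<in>set F. 1 \<le> s + length \<beta> \<and> set \<beta> \<subseteq> tuples (univ M) l"
      using js I0 I_real by (fastforce simp: F_def realizable_def)
    moreover have "A \<subseteq> loc_set M k l \<phi> F"
    proof
      fix a assume a: "a \<in> A"
      have "realizable M k l \<phi> (insert a (set bs))" if "(bs, j) \<in> I" for bs j
      proof -
        from that obtain A0 E where *: "A0 \<subseteq> A" "E \<in> \<E>" "set bs = A0 \<union> E" by (auto simp: I_def)
        then have "finite (insert a A0)" by (metis List.finite_set finite_Un finite_insert)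
        with * a compat have "realizable M k l \<phi> (insert a A0 \<union> E)"
          unfolding compatible_def by blast
        with * show ?thesis by simp
      qed
      then have "\<forall>(bs, j)\<in>I0. realizable M k l \<phi> (insert a (set bs))"
        using I0(1) by blast
      then show "a \<in> loc_set M k l \<phi> F"
        using a A(1) unfolding loc by blast
    qed
    ultimately obtain ys where ys: "length ys = n" "set ys \<subseteq> loc_set M k l \<phi> F"
      "\<not> realizable M k l \<phi> (set ys)"
      using fail by blast
    have ys_t: "set ys \<subseteq> tuples (univ M) l" using ys by (auto simp: loc_set_def)
    then have ys_l: "\<forall>b\<in>set ys. length b = l" by (auto simp: tuples_def)
    have len: "length (concat ys) = n * l" using length_concat_blocks[OF ys_l] ys by simp
    have bl: "block (concat ys) j = ys ! j" if "j < n" for j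
      using take_drop_concat[OF ys_l] that ys by (simp add: block_def)
    show ?thesis
    proof (intro bexI[of _ "concat ys"])
      show "concat ys \<in> tuples (univ M) (n * l)"
        using len ys_t by (auto simp: tuples_def)
      have g_ys: "case g of (\<psi>, d) \<Rightarrow> sat M (concat ys @ d) \<psi>"
        using ys ys_t bl by (auto simp: sat_g[OF len] realizable_def all_set_conv_all_nth)
      have G_ys: "case G (bs, j) of (\<psi>, d) \<Rightarrow> sat M (concat ys @ d) \<psi>" if "(bs, j) \<in> I0" for bs j
      proof -
        have I: "(bs, j) \<in> I" using that I0 by auto
        then have j: "j < n" by (simp add: I_def)
        then have "ys ! j \<in> loc_set M k l \<phi> F" using ys by auto
        then have "realizable M k l \<phi> (insert (ys ! j) (set bs))"
          using that unfolding loc by blast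
        then show ?thesis by (simp only: sat_G[OF len I] bl[OF j] realizable_def)
      qed
      show "\<forall>(\<psi>, d)\<in>\<Gamma>\<^sub>0. sat M (concat ys @ d) \<psi>"
      proof
        fix p assume "p \<in> \<Gamma>\<^sub>0"
        then consider "p = g" | bs j where "(bs, j) \<in> I0" "p = G (bs, j)"
          using I0(3) by (metis Diff_iff imageE singletonD surj_pair)
        then show "case p of (\<psi>, d) \<Rightarrow> sat M (concat ys @ d) \<psi>"
          by cases (simp_all only: g_ys G_ys)
      qed
    qed
  qed
  ultimately have "\<exists>v\<in>tuples (univ M) (n * l). \<forall>(\<psi>, d)\<in>insert g (G ` I). sat M (v @ d) \<psi>"
    by (rule saturatedD[where \<Gamma> = "insert g (G ` I)", OF sat])
  then obtain v where v: "v \<in> tuples (univ M) (n * l)"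
    and v_sat: "\<forall>(\<psi>, d)\<in>insert g (G ` I). sat M (v @ d) \<psi>"
    by (rule bexE)
  have v_g: "case g of (\<psi>, d) \<Rightarrow> sat M (v @ d) \<psi>"
    by (rule bspec[OF v_sat]) (rule insertI1)
  have v_G: "case G (bs, j) of (\<psi>, d) \<Rightarrow> sat M (v @ d) \<psi>" if "(bs, j) \<in> I" for bs j
    by (rule bspec[OF v_sat]) (intro insertI2 imageI that)
  have len: "length v = n * l" using v by (simp add: tuples_def)
  have block_t: "block v j \<in> tuples (univ M) l" if "j < n" for j
  proof -
    have "set (block v j) \<subseteq> set v"
      unfolding block_def by (meson set_drop_subset set_take_subset order_trans)
    moreover have "length (block v j) = l"
      using block_le[OF that] len by (simp add: block_def)
    ultimately show ?thesis using v by (auto simp: tuples_def)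
  qed
  show ?thesis
  proof (intro exI[of _ "map (block v) [0..<n]"] conjI ballI)
    show "\<not> realizable M k l \<phi> (set (map (block v) [0..<n]))"
    proof -
      have "\<not> (\<exists>a\<in>tuples (univ M) k. \<forall>j<n. sat M (a @ block v j) \<phi>)"
        using v_g sat_g[OF len] by simp
      then show ?thesis by (fastforce simp: realizable_def)
    qed
    fix y E assume "y \<in> set (map (block v) [0..<n])" and E: "E \<in> \<E>"
    then obtain j where j: "j < n" "y = block v j" by auto
    show "compatible M k l \<phi> A (insert y E)"
      unfolding compatible_def
    proof (intro allI impI)
      fix A0 assume A0: "finite A0 \<and> A0 \<subseteq> A"
      with fin E obtain bs where bs: "set bs = A0 \<union> E" by (metis finite_list finite_Un)
      with j A0 E have I: "(bs, j) \<in> I" by (auto simp: I_def)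
      then have "case G (bs, j) of (\<psi>, d) \<Rightarrow> sat M (v @ d) \<psi>" by (rule v_G)
      then have "realizable M k l \<phi> (insert y (set bs))"
        using block_t[OF j(1)] I_real[OF I] j(2) by (auto simp: sat_G[OF len I] realizable_def)
      with bs show "realizable M k l \<phi> (A0 \<union> insert y E)" by simp
    qed
  qed (use block_t in auto)
qed

text \<open>With \<open>listset\<close> the paths through the rows are the lists that choose one entry from each row. The
  induction adds a row in front; compatibility of the paths with \<open>A\<close> is what makes the next row
  possible, and without rows it is the consistency of \<open>A\<close>.\<close>

lemma array_exists:
  fixes M :: "('f, 'p, 'a) struct" and \<kappa> :: "'k rel"
  assumes sat: "saturated L \<kappa> M" and \<kappa>: "Cinfinite \<kappa>" and wf: "wf_fm L (k + l) \<phi>"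
    and A: "|A| <o \<kappa>" and base: "compatible M k l \<phi> A {}"
    and fail: "\<And>F. \<forall>(s, \<beta>)\<in>set F. 1 \<le> s + length \<beta> \<and> set \<beta> \<subseteq> tuples (univ M) l \<Longrightarrow>
      A \<subseteq> loc_set M k l \<phi> F \<Longrightarrow>
      \<exists>ys. length ys = n \<and> set ys \<subseteq> loc_set M k l \<phi> F \<and> \<not> realizable M k l \<phi> (set ys)"
  shows "\<exists>rows. length rows = m \<and>
    (\<forall>ys\<in>set rows. length ys = n \<and> set ys \<subseteq> tuples (univ M) l \<and> \<not> realizable M k l \<phi> (set ys)) \<and>
    (\<forall>p\<in>listset (map set rows). compatible M k l \<phi> A (set p))"
proof (induction m)
  case 0
  show ?case using base by simp
next
  case (Suc m)
  then obtain rows where rows: "length rows = m"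
    "\<forall>ys\<in>set rows. length ys = n \<and> set ys \<subseteq> tuples (univ M) l \<and> \<not> realizable M k l \<phi> (set ys)"
    "\<forall>p\<in>listset (map set rows). compatible M k l \<phi> A (set p)"
    by blast
  have A_t: "A \<subseteq> tuples (univ M) l"
  proof
    fix a assume "a \<in> A"
    with base have "realizable M k l \<phi> ({a} \<union> {})" unfolding compatible_def by blast
    then show "a \<in> tuples (univ M) l" by (simp add: realizable_def)
  qed
  have "\<exists>ys. length ys = n \<and> set ys \<subseteq> tuples (univ M) l \<and> \<not> realizable M k l \<phi> (set ys) \<and>
    (\<forall>y\<in>set ys. \<forall>E\<in>set ` listset (map set rows). compatible M k l \<phi> A (insert y E))"
    by (rule row_extension[OF sat \<kappa> wf A_t A _ _ _ fail])
      (use rows card_listset(1)[of "map set rows"] in auto)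
  then obtain ys where "length ys = n" "set ys \<subseteq> tuples (univ M) l"
    "\<not> realizable M k l \<phi> (set ys)"
    "\<forall>y\<in>set ys. \<forall>p\<in>listset (map set rows). compatible M k l \<phi> A (insert y (set p))"
    by auto
  with rows show ?case
    by (intro exI[of _ "ys # rows"]) (auto simp: set_Cons_def)
qed

section \<open>From arrays to the independence property\<close>

lemma independence_property_if_large_shattered:
  assumes "\<And>d. \<exists>S. finite S \<and> d \<le> card S \<and> S \<subseteq> tuples (univ M) l \<and>
    (\<forall>R\<subseteq>S. \<exists>a\<in>tuples (univ M) k. \<forall>b\<in>S. sat M (a @ b) \<phi> \<longleftrightarrow> b \<in> R)"
  shows "independence_property M k l \<phi>"
  unfolding independence_property_def
proof
  fix d :: nat
  obtain S where S: "finite S" "d \<le> card S" "S \<subseteq> tuples (univ M) l"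
    "\<forall>R\<subseteq>S. \<exists>a\<in>tuples (univ M) k. \<forall>b\<in>S. sat M (a @ b) \<phi> \<longleftrightarrow> b \<in> R"
    using assms[of d] by blast
  obtain b where b: "bij_betw b {0..<card S} S"
    using ex_bij_betw_nat_finite[OF S(1)] by blast
  have bS: "b i \<in> S" if "i < d" for i
    using b that S(2) by (auto simp: bij_betw_def)
  have inj: "b i = b j \<longleftrightarrow> i = j" if "i < d" "j < d" for i j
    using b that S(2) by (auto simp: bij_betw_def inj_on_def)
  show "\<exists>b. (\<forall>i<d. b i \<in> tuples (univ M) l) \<and>
      (\<forall>R\<subseteq>{..<d}. \<exists>a\<in>tuples (univ M) k. \<forall>i<d. sat M (a @ b i) \<phi> \<longleftrightarrow> i \<in> R)"
  proof (intro exI[of _ b] conjI allI impI)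
    fix R assume R: "R \<subseteq> {..<d}"
    then have "b ` R \<subseteq> S" using bS by auto
    then obtain a where a: "a \<in> tuples (univ M) k" "\<forall>c\<in>S. sat M (a @ c) \<phi> \<longleftrightarrow> c \<in> b ` R"
      using S(4) by blast
    have "b i \<in> b ` R \<longleftrightarrow> i \<in> R" if "i < d" for i
      using R inj[OF that] by (auto simp: image_iff)
    with a bS show "\<exists>a\<in>tuples (univ M) k. \<forall>i<d. sat M (a @ b i) \<phi> \<longleftrightarrow> i \<in> R"
      by (intro bexI[of _ a]) auto
  qed (use bS S(3) in auto)
qed

text \<open>Each row has \<open>n\<close> entries, so the number of points grows only linearly with the number of rows.
  The family \<open>\<F>\<close> of traces of \<open>\<phi>\<close> on the points satisfies the hypotheses of the covering bound: paths
  are realized and rows are not.\<close>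

lemma array_imp_independence_property:
  assumes "n > 0"
    and arrays: "\<And>m. \<exists>rows. length rows = m \<and>
      (\<forall>ys\<in>set rows. length ys = n \<and> set ys \<subseteq> tuples (univ M) l \<and> \<not> realizable M k l \<phi> (set ys)) \<and>
      (\<forall>p\<in>listset (map set rows). realizable M k l \<phi> (set p))"
  shows "independence_property M k l \<phi>"
proof (intro independence_property_if_large_shattered)
  fix d
  obtain m where m: "d * (n * m + 1) ^ d * (n - 1) ^ m < n ^ m"
    using exponential_beats_polynomial[OF \<open>n > 0\<close>] by blast
  obtain rows where len: "length rows = m"
    and rows: "\<And>ys. ys \<in> set rows \<Longrightarrow>
      length ys = n \<and> set ys \<subseteq> tuples (univ M) l \<and> \<not> realizable M k l \<phi> (set ys)"
    and paths: "\<And>p. p \<in> listset (map set rows) \<Longrightarrow> realizable M k l \<phi> (set p)"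
    using arrays[of m] by blast
  define Z where "Z = set (concat rows)"
  define \<F> where "\<F> = (\<lambda>a. {b \<in> Z. sat M (a @ b) \<phi>}) ` tuples (univ M) k"
  have Z: "finite Z" "Z \<subseteq> tuples (univ M) l" using rows by (auto simp: Z_def)
  have \<F>: "\<F> \<subseteq> Pow Z" by (auto simp: \<F>_def)
  have "card Z \<le> n * m"
  proof -
    have "card Z \<le> length (concat rows)" unfolding Z_def by (rule card_length)
    also have "\<dots> = n * m" using length_concat_blocks[of rows n] rows len by (simp add: mult.commute)
    finally show ?thesis .
  qed
  have in_Z: "set p \<subseteq> Z" if "p \<in> listset (map set rows)" for p
    using set_subset_Union_if_listset[OF that] by (simp add: Z_def)
  have "n ^ length (map set rows) \<le> card \<F> * (n - 1) ^ length (map set rows)"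
  proof (rule transversal_cover_bound)
    show "finite \<F>" using \<F> Z by (meson finite_Pow_iff finite_subset)
    fix R assume R: "R \<in> set (map set rows)"
    then show "finite R \<and> R \<noteq> {} \<and> card R \<le> n"
      using rows \<open>n > 0\<close> by (auto simp: card_length dest: rows intro: order_trans[OF card_length])
    fix T assume T: "T \<in> \<F>"
    from R obtain ys where ys: "ys \<in> set rows" "R = set ys" by auto
    with rows[OF ys(1)] T show "\<not> R \<subseteq> T"
      by (auto simp: \<F>_def realizable_def)
  next
    fix p assume p: "p \<in> listset (map set rows)"
    with paths[OF p] in_Z[OF p] show "\<exists>T\<in>\<F>. set p \<subseteq> T"
      by (auto simp: \<F>_def realizable_def)
  qed
  then have "d * (n * m + 1) ^ d * (n - 1) ^ m < card \<F> * (n - 1) ^ m"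
    using m len by (simp only: length_map)
  then have "d * (n * m + 1) ^ d < card \<F>" by (metis mult_less_cancel2)
  moreover have "d * (card Z + 1) ^ d \<le> d * (n * m + 1) ^ d"
    using \<open>card Z \<le> n * m\<close> by (intro mult_le_mono power_mono) auto
  ultimately have "\<not> card \<F> \<le> d * (card Z + 1) ^ d" by linarith
  then obtain S where S: "S \<subseteq> Z" "shatters \<F> S" "d \<le> card S"
    using sauer_shelah_bound[OF Z(1) \<F>] by (meson not_less)
  show "\<exists>S. finite S \<and> d \<le> card S \<and> S \<subseteq> tuples (univ M) l \<and>
    (\<forall>R\<subseteq>S. \<exists>a\<in>tuples (univ M) k. \<forall>b\<in>S. sat M (a @ b) \<phi> \<longleftrightarrow> b \<in> R)"
  proof (intro exI[of _ S] conjI allI impI)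
    fix R assume "R \<subseteq> S"
    with S(2) obtain T where "T \<in> \<F>" "T \<inter> S = R" by (rule shattersE)
    then obtain a where a: "a \<in> tuples (univ M) k" "{b \<in> Z. sat M (a @ b) \<phi>} \<inter> S = R"
      by (auto simp: \<F>_def)
    with S(1) show "\<exists>a\<in>tuples (univ M) k. \<forall>b\<in>S. sat M (a @ b) \<phi> \<longleftrightarrow> b \<in> R"
      by (intro bexI[of _ a]) auto
  qed (use S Z finite_subset in auto)
qed

section \<open>Localizations that force \<open>P\<^sub>n\<close>\<close>

text \<open>The set \<open>A\<close> itself serves as the complete graph of each arity.\<close>

lemma localization_if_contains_base:
  assumes "positive_base M k l \<phi> A" "A \<noteq> {}"
    and "\<forall>(s, \<beta>)\<in>set F. 1 \<le> s + length \<beta> \<and> set \<beta> \<subseteq> tuples B l"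
    and "A \<subseteq> loc_set M k l \<phi> F"
  shows "localization M k l \<phi> A B F"
  using assms by (auto simp: localization_def positive_base_def)

lemma positive_base_imp_compatible:
  assumes "positive_base M k l \<phi> A"
  shows "compatible M k l \<phi> A {}"
  unfolding compatible_def
proof (intro allI impI)
  fix A0 assume A0: "finite A0 \<and> A0 \<subseteq> A"
  then obtain bs where bs: "set bs = A0" using finite_list by blast
  with assms A0 have "P M k l \<phi> (length bs) bs"
    unfolding positive_base_def complete_graph_def by blast
  with bs show "realizable M k l \<phi> (A0 \<union> {})" by (simp add: P_iff_realizable)
qed

lemma localization_for_nonempty_base:
  fixes M :: "('f, 'p, 'a) struct" and \<kappa> :: "'k rel"
  assumes sat: "saturated L \<kappa> M" and \<kappa>: "Cinfinite \<kappa>" and wf: "wf_fm L (k + l) \<phi>"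
    and nip: "\<not> independence_property M k l \<phi>"
    and A: "positive_base M k l \<phi> A" "A \<noteq> {}" "|A| <o \<kappa>"
  shows "\<exists>F. localization M k l \<phi> A (univ M) F \<and>
    (\<forall>ys. length ys = n \<and> set ys \<subseteq> loc_set M k l \<phi> F \<longrightarrow> P M k l \<phi> n ys)"
proof (rule ccontr)
  assume contra: "\<not> ?thesis"
  have base: "compatible M k l \<phi> A {}" using A by (intro positive_base_imp_compatible)
  have fail: "\<exists>ys. length ys = n \<and> set ys \<subseteq> loc_set M k l \<phi> F \<and> \<not> realizable M k l \<phi> (set ys)"
    if "\<forall>(s, \<beta>)\<in>set F. 1 \<le> s + length \<beta> \<and> set \<beta> \<subseteq> tuples (univ M) l" "A \<subseteq> loc_set M k l \<phi> F" for F
    using contra localization_if_contains_base[OF A(1,2) that] by (auto simp: P_iff_realizable)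
  have compat_real: "realizable M k l \<phi> E" if "compatible M k l \<phi> A E" for E
    using that unfolding compatible_def by (metis Un_empty_left empty_subsetI finite.emptyI)
  \<comment> \<open>\<open>P\<^sub>0\<close> holds of the empty tuple, and the empty localization would already do.\<close>
  have "n > 0"
  proof (rule Nat.gr0I)
    assume "n = 0"
    then have "\<not> realizable M k l \<phi> {}"
      using fail[of "[]"] A(1) by (auto simp: loc_set_def positive_base_def complete_graph_def P1_def P_def)
    with compat_real[OF base] show False by simp
  qed
  moreover have "\<exists>rows. length rows = m \<and>
      (\<forall>ys\<in>set rows. length ys = n \<and> set ys \<subseteq> tuples (univ M) l \<and> \<not> realizable M k l \<phi> (set ys)) \<and>
      (\<forall>p\<in>listset (map set rows). realizable M k l \<phi> (set p))" for m
    using array_exists[OF sat \<kappa> wf A(3) base fail, of m] compat_real by blast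
  ultimately have "independence_property M k l \<phi>"
    by (rule array_imp_independence_property)
  with nip show False by simp
qed

theorem corollary6p18:
  fixes L :: "('f, 'p) lang" and T :: "('f, 'p) fm set" and \<phi> :: "('f, 'p) fm"
    and M :: "('f, 'p, 'a) struct" and \<kappa> :: "'k rel"
    and k l n :: nat and A :: "'a list set"
  assumes "complete_theory TYPE('a) L T"
    and "monster L T \<kappa> M"
    and "wf_fm L (k + l) \<phi>"
    and "convention TYPE('a) L T k l \<phi>"
    and "P1 M k l \<phi> \<noteq> {}"
    and "\<not> independence_property M k l \<phi>"
    and "positive_base M k l \<phi> A"
    and "|A| <o \<kappa>"
  shows "\<exists>F. localization M k l \<phi> A (univ M) F \<and>
           A \<subseteq> loc_set M k l \<phi> F \<and>
           (\<forall>ys. length ys = n \<and> set ys \<subseteq> loc_set M k l \<phi> F \<longrightarrow> P M k l \<phi> n ys)"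
proof -
  have sat: "saturated L \<kappa> M" and \<kappa>: "Cinfinite \<kappa>"
    using assms(2) by (auto simp: monster_def)
  \<comment> \<open>A localization around a larger base set is also one around \<open>A\<close>, so \<open>A\<close> may be assumed nonempty.\<close>
  obtain A' where A': "A \<subseteq> A'" "A' \<noteq> {}" "positive_base M k l \<phi> A'" "|A'| <o \<kappa>"
  proof (cases "A = {}")
    case True
    obtain a where a: "a \<in> P1 M k l \<phi>" using assms(5) by blast
    then have a': "realizable M k l \<phi> {a}" by (simp add: P1_def P_iff_realizable)
    have "complete_graph M k l \<phi> m {a}" for m
      unfolding complete_graph_def P_iff_realizable using a a' by (auto intro: realizable_mono)
    moreover have "|{a}| <o \<kappa>"
      using \<kappa> by (intro finite_card_less) auto
    ultimately show ?thesis using True that[of "{a}"] by (auto simp: positive_base_def)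
  next
    case False
    then show ?thesis using that assms by blast
  qed
  then obtain F where "localization M k l \<phi> A' (univ M) F"
    "\<forall>ys. length ys = n \<and> set ys \<subseteq> loc_set M k l \<phi> F \<longrightarrow> P M k l \<phi> n ys"
    using localization_for_nonempty_base[OF sat \<kappa> assms(3,6)] by blast
  moreover from this have "localization M k l \<phi> A (univ M) F" "A \<subseteq> loc_set M k l \<phi> F"
    using \<open>A \<subseteq> A'\<close> by (auto simp: localization_def)
  ultimately show ?thesis by blast
qed

end
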